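(* Let $\ell, v, \hat v, y$ be $\{0,1\}$-valued random variables on a common probability space, and let $\gamma_A\in[0,1]$. Suppose that for each $l\in\{0,1\}$ the conditional precision and conditional recall of $\hat v$ satisfy $$\Pr[v=1\mid \hat v=1,\ell=l]\ge 1-\gamma_A\quad\text{and}\quad \Pr[\hat v=1\mid v=1,\ell=l]\ge 1-\gamma_A.$$ Then $$|G-\hat G|\le 2\gamma_A.$$
   Context: $\ell$ is a sensitive attribute, $v$ a covariate, $\hat v$ a proxy for $v$, and $y$ a predicted outcome. The true and estimated conditional statistical parity gaps are $$G=\Pr[y=1\mid v=1,\ell=1]-\Pr[y=1\mid v=1,\ell=0],$$ $$\hat G=\Pr[y=1\mid \hat v=1,\ell=1]-\Pr[y=1\mid \hat v=1,\ell=0].$$ Every conditional probability that appears is assumed to be well defined, i.e. its conditioning event has positive probability. *)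

theory Defs
  imports "HOL-Probability.Probability"
begin

(* csp_gap M y w l is the conditional statistical parity gap with conditioning variable w:
   G is the instance where w is the covariate v, and G-hat the one where w is the proxy.
   Library conditional probabilities are quotients, equal to 0 when the conditioning event
   is null, so positivity of the conditioning events has to be assumed separately. *)
definition csp_gap ::
  "'a measure \<Rightarrow> ('a \<Rightarrow> nat) \<Rightarrow> ('a \<Rightarrow> nat) \<Rightarrow> ('a \<Rightarrow> nat) \<Rightarrow> real" where
  "csp_gap M y w l =
     \<P>(x in M. y x = 1 \<bar> w x = 1 \<and> l x = 1) - \<P>(x in M. y x = 1 \<bar> w x = 1 \<and> l x = 0)"

end

theory Submission
  imports Defs
begin

text \<open>
  Fix a group \<open>l = i\<close> and let \<open>A\<close>, \<open>B\<close> be the events \<open>v = 1\<close>, \<open>vhat = 1\<close> within it. Splitting off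
  the common part, with \<open>t = P(Y \<inter> A \<inter> B)\<close>, gives
  \<open>P(Y | A) - P(Y | B) \<le> t/P(A) - t/P(B) + 1 - P(A \<inter> B)/P(A)\<close>. The right-hand side is affine in
  \<open>t \<in> [0, P(A \<inter> B)]\<close>, and at the two endpoints it is \<open>1 - P(B | A)\<close> and \<open>1 - P(A | B)\<close>. So each
  group contributes at most \<open>\<gamma>\<close> to the difference of the gaps.
\<close>

lemma (in finite_measure) measure_ratio_diff_le:
  assumes sets: "A \<in> sets M" "B \<in> sets M" "Y \<in> sets M"
    and pos: "measure M A > 0" "measure M B > 0"
    and A: "measure M (A \<inter> B) / measure M A \<ge> 1 - g"
    and B: "measure M (A \<inter> B) / measure M B \<ge> 1 - g"
  shows "measure M (Y \<inter> A) / measure M A - measure M (Y \<inter> B) / measure M B \<le> g"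
proof -
  let ?a = "measure M A" and ?b = "measure M B" and ?c = "measure M (A \<inter> B)"
  let ?t = "measure M (Y \<inter> A \<inter> B)"
  \<comment> \<open>Crude on purpose: all of \<open>A - B\<close> is counted as if it lay in
    \<open>Y\<close>.\<close>
  have "measure M (Y \<inter> A) \<le> measure M ((Y \<inter> A \<inter> B) \<union> (A - B))"
    using sets by (intro finite_measure_mono) auto
  also have "\<dots> \<le> ?t + measure M (A - B)"
    using sets by (intro measure_Un_le) auto
  also have "measure M (A - B) = ?a - ?c"
    using sets finite_measure_Diff'[of A B] by simp
  finally have YA: "measure M (Y \<inter> A) \<le> ?t + ?a - ?c" by simp
  have YB: "?t \<le> measure M (Y \<inter> B)" and tc: "?t \<le> ?c"
    using sets by (auto intro!: finite_measure_mono)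
  have "measure M (Y \<inter> A) / ?a - measure M (Y \<inter> B) / ?b \<le> (?t + ?a - ?c) / ?a - ?t / ?b"
    using YA YB pos by (intro diff_mono divide_right_mono) auto
  also have "\<dots> = ?t * (1 / ?a - 1 / ?b) + (1 - ?c / ?a)"
    using pos by (simp add: field_simps)
  also have "\<dots> \<le> g"
  \<comment> \<open>The cases are the sign of the slope in \<open>?t\<close>. A nonpositive slope
    puts the worst case at \<open>?t = 0\<close>, where \<open>A\<close> gives the bound; otherwise
    it is at \<open>?t = ?c\<close>, where \<open>B\<close> does.\<close>
  proof (cases "?b \<le> ?a")
    case True
    then have "?t * (1 / ?a - 1 / ?b) \<le> 0"
      using pos by (intro mult_nonneg_nonpos) (auto simp: frac_le)
    with A show ?thesis by linarith
  next
    case False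
    then have "?t * (1 / ?a - 1 / ?b) \<le> ?c * (1 / ?a - 1 / ?b)"
      using pos tc by (intro mult_right_mono) (auto simp: frac_le)
    also have "\<dots> = ?c / ?a - ?c / ?b"
      by (simp add: right_diff_distrib)
    finally show ?thesis using B by linarith
  qed
  finally show ?thesis .
qed

text \<open>Exchanging \<open>P\<close> and \<open>Q\<close> only swaps the last two hypotheses, so
  the one-sided ratio bound applies in both directions and yields the absolute value.\<close>

lemma (in prob_space) cond_prob_diff_le:
  assumes meas: "{x \<in> space M. P x} \<in> sets M" "{x \<in> space M. Q x} \<in> sets M"
      "{x \<in> space M. R x} \<in> sets M"
    and pos: "\<P>(x in M. P x) > 0" "\<P>(x in M. Q x) > 0"
    and PQ: "\<P>(x in M. P x \<bar> Q x) \<ge> 1 - g" and QP: "\<P>(x in M. Q x \<bar> P x) \<ge> 1 - g"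
  shows "\<bar>\<P>(x in M. R x \<bar> P x) - \<P>(x in M. R x \<bar> Q x)\<bar> \<le> g"
proof -
  have eq: "\<P>(x in M. S x \<bar> T x) =
      prob ({x \<in> space M. S x} \<inter> {x \<in> space M. T x}) / prob {x \<in> space M. T x}" for S T
    by (auto simp: cond_prob_def intro!: arg_cong2[where f = "(/)"] arg_cong[where f = prob])
  note le = measure_ratio_diff_le[OF _ _ meas(3)]
  show ?thesis
    using le[OF meas(1,2) pos] le[OF meas(2,1) pos(2,1)] PQ QP
    unfolding eq by (simp add: Int_commute abs_le_iff)
qed

theorem theorem5p1:
  fixes M :: "'a measure"
    and l v vhat y :: "'a \<Rightarrow> nat"
    and \<gamma>\<^sub>A :: real
  assumes "prob_space M"
    and "l \<in> measurable M (count_space {0, 1})"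
    and "v \<in> measurable M (count_space {0, 1})"
    and "vhat \<in> measurable M (count_space {0, 1})"
    and "y \<in> measurable M (count_space {0, 1})"
    and "0 \<le> \<gamma>\<^sub>A" and "\<gamma>\<^sub>A \<le> 1"
    and "\<And>i. i \<in> {0, 1} \<Longrightarrow> \<P>(x in M. v x = 1 \<and> l x = i) > 0"
    and "\<And>i. i \<in> {0, 1} \<Longrightarrow> \<P>(x in M. vhat x = 1 \<and> l x = i) > 0"
    and precision: "\<And>i. i \<in> {0, 1} \<Longrightarrow>
      \<P>(x in M. v x = 1 \<bar> vhat x = 1 \<and> l x = i) \<ge> 1 - \<gamma>\<^sub>A"
    and recall: "\<And>i. i \<in> {0, 1} \<Longrightarrow>
      \<P>(x in M. vhat x = 1 \<bar> v x = 1 \<and> l x = i) \<ge> 1 - \<gamma>\<^sub>A"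
  shows "\<bar>csp_gap M y v l - csp_gap M y vhat l\<bar> \<le> 2 * \<gamma>\<^sub>A"
proof -
  interpret prob_space M by fact
  have ev: "{x \<in> space M. f x = i} \<in> sets M"
    if "f \<in> measurable M (count_space {0, 1})" "i \<in> {0, 1}" for f :: "'a \<Rightarrow> nat" and i
    using measurable_sets[OF that(1), of "{i}"] that(2)
    by (simp add: vimage_def Int_def conj_commute)
  \<comment> \<open>The group condition is part of both events being compared, whereas
    \<open>precision\<close> and \<open>recall\<close> have it only in the conditioning event;
    repeating it changes nothing.\<close>
  have conj: "\<P>(x in M. P x \<and> R x \<bar> Q x \<and> R x) = \<P>(x in M. P x \<bar> Q x \<and> R x)" for P Q R
    unfolding cond_prob_def by (simp add: conj_ac)
  have "\<bar>\<P>(x in M. y x = 1 \<bar> v x = 1 \<and> l x = i)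
      - \<P>(x in M. y x = 1 \<bar> vhat x = 1 \<and> l x = i)\<bar> \<le> \<gamma>\<^sub>A" if i: "i \<in> {0, 1}" for i
  proof (rule cond_prob_diff_le)
    show "{x \<in> space M. v x = 1 \<and> l x = i} \<in> sets M"
         "{x \<in> space M. vhat x = 1 \<and> l x = i} \<in> sets M"
         "{x \<in> space M. y x = 1} \<in> sets M"
      using i assms(2-5) by (auto intro!: sets.sets_Collect_conj ev)
  qed (use i assms(8,9) precision recall conj in auto)
  \<comment> \<open>The difference of the gaps is the group 1 difference minus the group 0
    difference, hence the factor 2.\<close>
  from this[of 0] this[of 1] show ?thesis
    unfolding csp_gap_def by simp
qed

end
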